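(* Let $m,r>0$ and let $\mathbb{I}=\mathrm{diag}(I_1,I_2,I_3)$ with $I_1,I_2,I_3>0$. On $\mathbb{R}^3\times\mathbb{R}^3\ni(\gamma,K)$ let $\Omega=\Omega(\gamma,K)$ be determined by $K=\mathbb{I}\Omega+mr^2(\Omega\cdot\gamma)\gamma$. The characteristic distribution of the almost Poisson bracket $$\{f,g\}'_{\mathrm{Rank}1}=-\bigl(K-mr^2\Omega+mr^2(\Omega\cdot\gamma)\gamma\bigr)\cdot\left(\frac{\partial f}{\partial K}\times\frac{\partial g}{\partial K}\right)-\gamma\cdot\left(\frac{\partial f}{\partial K}\times\frac{\partial g}{\partial\gamma}-\frac{\partial g}{\partial K}\times\frac{\partial f}{\partial\gamma}\right)$$ is not integrable.
   Context: An almost Poisson bracket is a skew-symmetric bilinear bracket on smooth functions satisfying the Leibniz rule (not necessarily the Jacobi identity). The (almost) Hamiltonian vector field of $f$ is $X_f$ with $X_f(g)=\{g,f\}$. The characteristic distribution is the (possibly singular) distribution whose fibers are spanned by the (almost) Hamiltonian vector fields. It is integrable if through every point passes an immersed submanifold whose tangent spaces are the fibers of the distribution; in particular the Lie bracket of two vector fields with values in an integrable distribution again has values in it. *)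

theory Defs
  imports "HOL-Analysis.Analysis"
begin

section \<open>Smooth maps\<close>

primrec Ck_on :: "nat \<Rightarrow> 'a::real_normed_vector set \<Rightarrow> ('a \<Rightarrow> 'b::real_normed_vector) \<Rightarrow> bool"
  where
    "Ck_on 0 S f \<longleftrightarrow> continuous_on S f"
  | "Ck_on (Suc n) S f \<longleftrightarrow>
       (\<forall>x\<in>S. f differentiable (at x)) \<and>
       (\<forall>v. Ck_on n S (\<lambda>x. frechet_derivative f (at x) v))"

text \<open>The recursion above is meaningful on open sets only. On an arbitrary set, a map is smooth if
  it is locally the restriction of a smooth map defined on an open set; this is needed
  for maps defined on an open subset of a proper linear subspace.\<close>

definition smooth_on :: "'a::real_normed_vector set \<Rightarrow> ('a \<Rightarrow> 'b::real_normed_vector) \<Rightarrow> bool"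
  where "smooth_on S f \<longleftrightarrow>
    (\<forall>x\<in>S. \<exists>W g. open W \<and> x \<in> W \<and> (\<forall>n. Ck_on n W g) \<and> (\<forall>y\<in>W \<inter> S. g y = f y))"


section \<open>Immersed submanifolds and integrable distributions\<close>

text \<open>
  An immersed submanifold of a Euclidean space is a subset \<^term>\<open>topspace T\<close>, with a topology \<open>T\<close>
  of its own (in general finer than the subspace topology) and a smooth structure, such that
  the inclusion is an immersion. The smooth structure is given by an atlas \<open>A\<close> of
  local parametrisations \<open>(U, \<phi>)\<close>, the inverses of charts. Since its dimension is at most that of the
  ambient space, the model space can be taken to be a linear subspace \<open>V\<close> of the ambient
  space; this allows the dimension to vary without varying a type.

  The inclusion read in the chart \<open>(U, \<phi>)\<close> is \<open>\<phi>\<close> itself. As \<open>U\<close> is open in \<open>V\<close>, the derivative of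
  \<open>\<phi>\<close> within \<open>U\<close> is determined on \<open>V\<close>, but not outside \<open>V\<close>.
\<close>

definition immersed_submanifold ::
  "'a::euclidean_space topology \<Rightarrow> 'a set \<Rightarrow> ('a set \<times> ('a \<Rightarrow> 'a)) set \<Rightarrow> bool"
  where "immersed_submanifold T V A \<longleftrightarrow>
    subspace V \<and>
    Hausdorff_space T \<and>
    (\<exists>B. countable B \<and> (\<forall>b\<in>B. openin T b) \<and>
         (\<forall>S x. openin T S \<and> x \<in> S \<longrightarrow> (\<exists>b\<in>B. x \<in> b \<and> b \<subseteq> S))) \<and>
    topspace T = (\<Union>(U, \<phi>)\<in>A. \<phi> ` U) \<and>
    (\<forall>(U, \<phi>)\<in>A. openin (top_of_set V) U \<and> openin T (\<phi> ` U) \<and>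
         homeomorphic_map (top_of_set U) (subtopology T (\<phi> ` U)) \<phi>) \<and>
    (\<forall>(U, \<phi>)\<in>A. \<forall>(U', \<psi>)\<in>A. smooth_on (U \<inter> \<phi> -` (\<psi> ` U')) (inv_into U' \<psi> \<circ> \<phi>)) \<and>
    (\<forall>(U, \<phi>)\<in>A. smooth_on U \<phi> \<and>
         (\<forall>u\<in>U. \<exists>\<phi>'. (\<phi> has_derivative \<phi>') (at u within U) \<and> inj_on \<phi>' V))"

definition tangent_space ::
  "'a::euclidean_space set \<Rightarrow> ('a set \<times> ('a \<Rightarrow> 'a)) set \<Rightarrow> 'a \<Rightarrow> 'a set"
  where "tangent_space V A q =
    {\<phi>' v | U \<phi> u \<phi>' v. (U, \<phi>) \<in> A \<and> u \<in> U \<and> \<phi> u = q \<and>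
                        (\<phi> has_derivative \<phi>') (at u within U) \<and> v \<in> V}"

text \<open>A possibly singular distribution is given by its fibres \<open>D x\<close>, whose dimension may depend
  on \<open>x\<close>.\<close>

definition integrable_distribution :: "('a::euclidean_space \<Rightarrow> 'a set) \<Rightarrow> bool"
  where "integrable_distribution D \<longleftrightarrow>
    (\<forall>p. \<exists>T V A. immersed_submanifold T V A \<and> p \<in> topspace T \<and>
                 (\<forall>q\<in>topspace T. tangent_space V A q = D q))"


section \<open>Almost Hamiltonian vector fields and the characteristic distribution\<close>

type_synonym 'a bracket = "('a \<Rightarrow> real) \<Rightarrow> ('a \<Rightarrow> real) \<Rightarrow> 'a \<Rightarrow> real"

text \<open>The sign convention is \<open>X\<^sub>f(g) = {g, f}\<close>.\<close>

definition hamiltonian_vf :: "'a::euclidean_space bracket \<Rightarrow> ('a \<Rightarrow> real) \<Rightarrow> ('a \<Rightarrow> 'a) \<Rightarrow> bool"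
  where "hamiltonian_vf B f X \<longleftrightarrow>
    (\<forall>g. smooth_on UNIV g \<longrightarrow> (\<forall>x. frechet_derivative g (at x) (X x) = B g f x))"

definition characteristic_distribution :: "'a::euclidean_space bracket \<Rightarrow> 'a \<Rightarrow> 'a set"
  where "characteristic_distribution B x =
    span {X x | f X. smooth_on UNIV f \<and> hamiltonian_vf B f X}"


section \<open>The bracket\<close>

text \<open>Points of the phase space are pairs \<open>(\<gamma>, K)\<close>.\<close>

definition grad_gamma :: "((real^3) \<times> (real^3) \<Rightarrow> real) \<Rightarrow> (real^3) \<times> (real^3) \<Rightarrow> real^3"
  where "grad_gamma f = (\<lambda>(\<gamma>, K). \<chi> i. frechet_derivative (\<lambda>y. f (y, K)) (at \<gamma>) (axis i 1))"

definition grad_K :: "((real^3) \<times> (real^3) \<Rightarrow> real) \<Rightarrow> (real^3) \<times> (real^3) \<Rightarrow> real^3"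
  where "grad_K f = (\<lambda>(\<gamma>, K). \<chi> i. frechet_derivative (\<lambda>y. f (\<gamma>, y)) (at K) (axis i 1))"

definition diag_matrix :: "real^3 \<Rightarrow> real^3^3"
  where "diag_matrix d = (\<chi> i j. if i = j then d $ i else 0)"

definition Omega :: "real \<Rightarrow> real \<Rightarrow> real^3^3 \<Rightarrow> real^3 \<Rightarrow> real^3 \<Rightarrow> real^3"
  where "Omega m r II \<gamma> K = (THE \<Omega>. K = II *v \<Omega> + (m * r\<^sup>2 * (\<Omega> \<bullet> \<gamma>)) *\<^sub>R \<gamma>)"

definition rank1_bracket :: "real \<Rightarrow> real \<Rightarrow> real^3^3 \<Rightarrow> ((real^3) \<times> (real^3)) bracket"
  where "rank1_bracket m r II f g = (\<lambda>(\<gamma>, K).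
    let \<Omega> = Omega m r II \<gamma> K;
        f\<^sub>\<gamma> = grad_gamma f (\<gamma>, K); f\<^sub>K = grad_K f (\<gamma>, K);
        g\<^sub>\<gamma> = grad_gamma g (\<gamma>, K); g\<^sub>K = grad_K g (\<gamma>, K)
    in - ((K - (m * r\<^sup>2) *\<^sub>R \<Omega> + (m * r\<^sup>2 * (\<Omega> \<bullet> \<gamma>)) *\<^sub>R \<gamma>) \<bullet> cross3 f\<^sub>K g\<^sub>K)
       - \<gamma> \<bullet> (cross3 f\<^sub>K g\<^sub>\<gamma> - cross3 g\<^sub>K f\<^sub>\<gamma>))"


section \<open>Well-definedness\<close>

text \<open>The description in the definition of \<^const>\<open>Omega\<close> is proper.\<close>

lemma Omega_unique_existence:
  fixes d \<gamma> K :: "real^3" and m r :: real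
  assumes "m > 0" and d: "\<And>i. d $ i > 0"
  shows "\<exists>!\<Omega>. K = diag_matrix d *v \<Omega> + (m * r\<^sup>2 * (\<Omega> \<bullet> \<gamma>)) *\<^sub>R \<gamma>"
proof -
  define L where "L = (\<lambda>w. diag_matrix d *v w + (m * r\<^sup>2 * (w \<bullet> \<gamma>)) *\<^sub>R \<gamma>)"
  have lin: "linear L"
    by (auto intro!: linearI simp: L_def matrix_vector_right_distrib inner_left_distrib
        algebra_simps matrix_vector_mult_scaleR)
  have "w = 0" if "L w = 0" for w
  proof -
    have "w \<bullet> (diag_matrix d *v w) = d$1 * (w$1)\<^sup>2 + d$2 * (w$2)\<^sup>2 + d$3 * (w$3)\<^sup>2"
      by (simp add: diag_matrix_def matrix_vector_mult_def inner_vec_def sum_3 power2_eq_square)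
    then have "w \<bullet> L w = d$1 * (w$1)\<^sup>2 + d$2 * (w$2)\<^sup>2 + d$3 * (w$3)\<^sup>2 + m * r\<^sup>2 * (w \<bullet> \<gamma>)\<^sup>2"
      by (simp add: L_def inner_right_distrib power2_eq_square)
    moreover have "d$1 * (w$1)\<^sup>2 \<ge> 0" "d$2 * (w$2)\<^sup>2 \<ge> 0" "d$3 * (w$3)\<^sup>2 \<ge> 0"
        "m * r\<^sup>2 * (w \<bullet> \<gamma>)\<^sup>2 \<ge> 0"
      using assms by (auto intro!: mult_nonneg_nonneg simp: less_imp_le)
    moreover have "w \<bullet> L w = 0"
      using that by simp
    ultimately have "d$1 * (w$1)\<^sup>2 = 0" "d$2 * (w$2)\<^sup>2 = 0" "d$3 * (w$3)\<^sup>2 = 0"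
      by linarith+
    then show "w = 0"
      using d[of 1] d[of 2] d[of 3] by (simp add: vec_eq_iff forall_3)
  qed
  then have inj: "inj L"
    using linear_injective_0[OF lin] by blast
  then have "surj L"
    using linear_injective_imp_surjective[OF lin] by blast
  then have "\<exists>!w. K = L w"
    using inj by (auto simp: inj_def surj_def)
  then show ?thesis
    by (simp only: L_def)
qed

lemma smooth_imp_differentiable:
  assumes "smooth_on UNIV g"
  shows "g differentiable (at x)"
proof -
  obtain W h where W: "open W" "x \<in> W" "\<forall>n. Ck_on n W h" "\<forall>y\<in>W. h y = g y"
    using assms unfolding smooth_on_def by simp blast
  then have "Ck_on (Suc 0) W h" by blast
  then have "h differentiable (at x)" using W(2) by simp
  then obtain h' where "(h has_derivative h') (at x)"
    by (auto simp: differentiable_def)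
  then have "(g has_derivative h') (at x)"
    by (rule has_derivative_transform_within_open[OF _ W(1,2)]) (use W in auto)
  then show ?thesis by (auto simp: differentiable_def)
qed

lemma frechet_derivative_eq_grads:
  assumes "g differentiable (at (\<gamma>, K))"
  shows "frechet_derivative g (at (\<gamma>, K)) (u, v) =
    u \<bullet> grad_gamma g (\<gamma>, K) + v \<bullet> grad_K g (\<gamma>, K)"
proof -
  let ?D = "frechet_derivative g (at (\<gamma>, K))"
  have D: "(g has_derivative ?D) (at (\<gamma>, K))"
    using assms frechet_derivative_works by blast
  have lin: "linear ?D"
    using D by (rule has_derivative_linear)
  have "((\<lambda>y. g (y, K)) has_derivative (\<lambda>y. ?D (y, 0))) (at \<gamma>)"
    by (rule has_derivative_compose[of "\<lambda>y. (y, K)" "\<lambda>y. (y, 0)" _ _ g ?D])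
       (auto intro!: derivative_eq_intros D)
  then have 1: "grad_gamma g (\<gamma>, K) = (\<chi> i. ?D (axis i 1, 0))"
    by (simp add: grad_gamma_def frechet_derivative_at[symmetric])
  have "((\<lambda>y. g (\<gamma>, y)) has_derivative (\<lambda>y. ?D (0, y))) (at K)"
    by (rule has_derivative_compose[of "\<lambda>y. (\<gamma>, y)" "\<lambda>y. (0, y)" _ _ g ?D])
       (auto intro!: derivative_eq_intros D)
  then have 2: "grad_K g (\<gamma>, K) = (\<chi> i. ?D (0, axis i 1))"
    by (simp add: grad_K_def frechet_derivative_at[symmetric])
  have "(u, v) = (\<Sum>i\<in>UNIV. u$i *\<^sub>R (axis i 1, 0)) + (\<Sum>i\<in>UNIV. v$i *\<^sub>R (0, axis i 1))"
    by (simp add: sum_3 vec_eq_iff forall_3 axis_def)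
  then have "?D (u, v) = (\<Sum>i\<in>UNIV. u$i * ?D (axis i 1, 0)) + (\<Sum>i\<in>UNIV. v$i * ?D (0, axis i 1))"
    by (simp only: linear_add[OF lin] linear_sum[OF lin] linear_scale[OF lin]) simp
  then show ?thesis
    by (simp add: 1 2 inner_vec_def)
qed

text \<open>Every function has an almost Hamiltonian vector field for the bracket, so the set spanning
  the characteristic distribution is not accidentally empty.\<close>

lemma hamiltonian_vf_rank1:
  "hamiltonian_vf (rank1_bracket m r II) f (\<lambda>(\<gamma>, K).
     let \<Omega> = Omega m r II \<gamma> K; a = grad_K f (\<gamma>, K); b = grad_gamma f (\<gamma>, K)
     in (cross3 \<gamma> a,
         cross3 (K - (m * r\<^sup>2) *\<^sub>R \<Omega> + (m * r\<^sup>2 * (\<Omega> \<bullet> \<gamma>)) *\<^sub>R \<gamma>) a + cross3 \<gamma> b))"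
proof -
  have "cross3 \<gamma> a \<bullet> d + (cross3 M a + cross3 \<gamma> b) \<bullet> c =
      - (M \<bullet> cross3 c a) - \<gamma> \<bullet> (cross3 c b - cross3 a d)" for \<gamma> M a b c d :: "real^3"
    by (simp add: cross3_simps)
  then show ?thesis
    unfolding hamiltonian_vf_def rank1_bracket_def
    by (auto simp: Let_def frechet_derivative_eq_grads smooth_imp_differentiable)
qed

end

(* Vectors (u, v) of the distribution satisfy gamma . u = 0 and
   alpha(u, v) = gamma . v + K . u - m r^2 Omega . u = 0, so alpha pulls back to zero on a leaf, and
   hence so does d alpha: in a chart the symmetric second derivatives of the inclusion cancel
   and only the term - m r^2 dOmega wedge dgamma remains. At (e_1, 0) this term does not vanish on the
   vectors (0, e_2) and (e_2, 0) of the distribution, which both lie in the tangent space of one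
   chart of the leaf. *)

theory Submission
  imports Defs
begin

section \<open>Derivatives on open subsets of a subspace\<close>

text \<open>A line through a point of S in a direction of V stays in S for small t of either sign.
  So derivatives within S, which need not be open, reduce to ordinary derivatives in t at 0.\<close>

lemma has_vector_derivative_along_subspace:
  fixes x :: "'a::real_normed_vector"
  assumes V: "subspace V" and S: "openin (top_of_set V) S" and x: "x \<in> S" and v: "v \<in> V"
    and f: "(f has_derivative f') (at x within S)"
  shows "((\<lambda>t. f (x + t *\<^sub>R v)) has_vector_derivative f' v) (at 0)"
    and "eventually (\<lambda>t. x + t *\<^sub>R v \<in> S) (at (0::real))"
proof -
  obtain N where N: "open N" "S = V \<inter> N"
    using S by (auto simp: openin_open)
  define T where "T = {t. x + t *\<^sub>R v \<in> S}"
  have "T = (\<lambda>t. x + t *\<^sub>R v) -` N"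
    using N x v V by (auto simp: T_def subspace_add subspace_scale)
  moreover have "open ((\<lambda>t. x + t *\<^sub>R v) -` N)"
    by (intro open_vimage N continuous_intros)
  ultimately have "open T" by simp
  have "0 \<in> T" using x by (simp add: T_def)
  note T = \<open>open T\<close> this
  have lin: "f' (t *\<^sub>R v) = t *\<^sub>R f' v" for t
    using has_derivative_linear[OF f] by (rule linear_scale)
  have "((\<lambda>t. f (x + t *\<^sub>R v)) has_derivative (\<lambda>t. f' (t *\<^sub>R v))) (at 0 within T)"
  proof (rule has_derivative_in_compose[where f = "\<lambda>t. x + t *\<^sub>R v" and f' = "\<lambda>t. t *\<^sub>R v"])
    show "((\<lambda>t. x + t *\<^sub>R v) has_derivative (\<lambda>t. t *\<^sub>R v)) (at 0 within T)"
      by (auto intro!: derivative_eq_intros)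
    show "(f has_derivative f') (at (x + 0 *\<^sub>R v) within (\<lambda>t. x + t *\<^sub>R v) ` T)"
      using f by (auto simp: T_def intro: has_derivative_subset)
  qed
  then show "((\<lambda>t. f (x + t *\<^sub>R v)) has_vector_derivative f' v) (at 0)"
    using T by (simp only: lin has_vector_derivative_def at_within_open)
  show "eventually (\<lambda>t. x + t *\<^sub>R v \<in> S) (at (0::real))"
    using T by (auto simp: eventually_at_topological T_def)
qed

text \<open>Agreement is claimed on V only: if V is proper, a derivative within S can take any
  values transversally to V.\<close>

lemma has_derivative_unique_on_subspace:
  fixes x :: "'a::real_normed_vector"
  assumes "subspace V" "openin (top_of_set V) S" "x \<in> S" "v \<in> V"
    and "(f has_derivative f') (at x within S)" "(f has_derivative f'') (at x within S)"
  shows "f' v = f'' v"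
  using has_vector_derivative_along_subspace(1)[OF assms(1-5)]
    has_vector_derivative_along_subspace(1)[OF assms(1-4,6)]
  by (rule vector_derivative_unique_at)

lemma has_vector_derivative_imp_quotient_tendsto:
  assumes "(f has_vector_derivative f') (at x)"
  shows "((\<lambda>h. (f (x + h) - f x) /\<^sub>R h) \<longlongrightarrow> f') (at 0)"
proof -
  have "((\<lambda>h. norm (f (x + h) - f x - h *\<^sub>R f') / norm h) \<longlongrightarrow> 0) (at 0)"
    using assms by (simp add: has_vector_derivative_def has_derivative_at)
  moreover have "norm (f (x + h) - f x - h *\<^sub>R f') / norm h = norm ((f (x + h) - f x) /\<^sub>R h - f')"
    if "h \<noteq> 0" for h
  proof -
    have "(f (x + h) - f x) /\<^sub>R h - f' = (f (x + h) - f x - h *\<^sub>R f') /\<^sub>R h"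
      using that by (simp add: scaleR_right_diff_distrib)
    then show ?thesis by (simp add: divide_inverse mult.commute)
  qed
  then have "eventually (\<lambda>h. norm (f (x + h) - f x - h *\<^sub>R f') / norm h =
      norm ((f (x + h) - f x) /\<^sub>R h - f')) (at 0)"
    by (simp add: eventually_at_filter)
  ultimately have "((\<lambda>h. norm ((f (x + h) - f x) /\<^sub>R h - f')) \<longlongrightarrow> 0) (at 0)"
    by (rule Lim_transform_eventually)
  then show ?thesis
    by (rule LIM_zero_cancel[OF tendsto_norm_zero_cancel])
qed

text \<open>The difference quotients lie in Z, and Z is closed because it is a subspace of a
  Euclidean space. With \<open>Z = {0}\<close> this differentiates an identity known on S
  alone.\<close>

lemma has_derivative_maps_subspace:
  fixes x :: "'a::real_normed_vector" and f :: "'a \<Rightarrow> 'b::euclidean_space"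
  assumes V: "subspace V" "openin (top_of_set V) S" "x \<in> S" "v \<in> V"
    and f: "(f has_derivative f') (at x within S)"
    and Z: "subspace Z" "f ` S \<subseteq> Z"
  shows "f' v \<in> Z"
proof -
  have "((\<lambda>t. (f (x + t *\<^sub>R v) - f x) /\<^sub>R t) \<longlongrightarrow> f' v) (at 0)"
    using has_vector_derivative_imp_quotient_tendsto[OF has_vector_derivative_along_subspace(1)[OF V f]]
    by simp
  moreover have "eventually (\<lambda>t. (f (x + t *\<^sub>R v) - f x) /\<^sub>R t \<in> Z) (at 0)"
    using has_vector_derivative_along_subspace(2)[OF V f]
    by eventually_elim (use Z V(3) in \<open>auto intro!: subspace_scale subspace_diff\<close>)
  ultimately show ?thesis
    using closed_subspace[OF Z(1)] by (intro Lim_in_closed_set) auto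
qed

section \<open>Symmetry of second derivatives\<close>

text \<open>The second difference in the directions \<open>v\<close> and \<open>w\<close> is symmetric, and by the mean value theorem
  it is approximated both by \<open>t\<^sup>2 A w\<close> and by \<open>t\<^sup>2 B v\<close>.\<close>

lemma second_difference_approx:
  fixes f :: "'a::real_normed_vector \<Rightarrow> real"
  assumes W: "open W" "x \<in> W" and D: "\<And>y. y \<in> W \<Longrightarrow> (f has_derivative D y) (at y)"
    and A: "((\<lambda>y. D y v) has_derivative A) (at x)" and e: "e > 0"
  shows "\<exists>d>0. \<forall>t. 0 < t \<and> t < d \<longrightarrow>
    \<bar>f (x + t *\<^sub>R v + t *\<^sub>R w) - f (x + t *\<^sub>R v) - f (x + t *\<^sub>R w) + f x - t\<^sup>2 * A w\<bar> \<le> e * t\<^sup>2"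
proof -
  \<comment> \<open>The factor n bounds \<open>norm (s *\<^sub>R v + q *\<^sub>R w)\<close> by
    \<open>t * n\<close> for s and q in [0, t]; the summand 1 keeps it positive when v and w
    vanish.\<close>
  define n where "n = norm v + norm w + 1"
  have n: "n > 0" by (simp add: n_def add_nonneg_pos)
  \<comment> \<open>Two errors of size \<open>e' * (t * n)\<close> will add up to
    \<open>e * t\<close>; the mean value theorem supplies the other factor t.\<close>
  define e' where "e' = e / (2 * n)"
  have e': "e' > 0" using e n by (simp add: e'_def)
  obtain d1 where d1: "d1 > 0" "ball x d1 \<subseteq> W"
    using W open_contains_ball by blast
  obtain d2 where d2: "d2 > 0"
    "\<And>y. norm (y - x) < d2 \<Longrightarrow> norm (D y v - D x v - A (y - x)) \<le> e' * norm (y - x)"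
    using A e' unfolding has_derivative_at_alt by blast
  have lin: "linear A" using A by (rule has_derivative_linear)
  define d where "d = min d1 d2 / n"
  have "d > 0" using d1 d2 n by (simp add: d_def)
  moreover have "\<bar>f (x + t *\<^sub>R v + t *\<^sub>R w) - f (x + t *\<^sub>R v) - f (x + t *\<^sub>R w) + f x - t\<^sup>2 * A w\<bar> \<le> e * t\<^sup>2"
    if t: "0 < t" "t < d" for t
  proof -
    have tn: "t * n < d1" "t * n < d2"
      using t n by (auto simp: d_def field_simps)
    have near: "norm (s *\<^sub>R v + q *\<^sub>R w) \<le> t * n" if "0 \<le> s" "s \<le> t" "0 \<le> q" "q \<le> t" for s q
    proof -
      have "norm (s *\<^sub>R v + q *\<^sub>R w) \<le> s * norm v + q * norm w"
        using norm_triangle_ineq[of "s *\<^sub>R v" "q *\<^sub>R w"] that by simp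
      also have "\<dots> \<le> t * norm v + t * norm w"
        using that by (intro add_mono mult_right_mono) auto
      also have "\<dots> \<le> t * n" using t by (simp add: n_def algebra_simps)
      finally show ?thesis .
    qed
    have inW: "x + s *\<^sub>R v + q *\<^sub>R w \<in> W" if "0 \<le> s" "s \<le> t" "0 \<le> q" "q \<le> t" for s q
    proof -
      have "dist x (x + s *\<^sub>R v + q *\<^sub>R w) = norm (s *\<^sub>R v + q *\<^sub>R w)"
        by (simp add: dist_norm add.assoc flip: norm_minus_cancel[of "s *\<^sub>R v + q *\<^sub>R w"])
      then show ?thesis using near[OF that] tn d1 by (auto simp: subset_iff)
    qed
    have der: "((\<lambda>s. f (x + s *\<^sub>R v + q *\<^sub>R w)) has_real_derivative D (x + s *\<^sub>R v + q *\<^sub>R w) v) (at s)"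
      if "0 \<le> s" "s \<le> t" "0 \<le> q" "q \<le> t" for s q
    proof -
      have "((\<lambda>s. x + s *\<^sub>R v + q *\<^sub>R w) has_derivative (\<lambda>s. s *\<^sub>R v)) (at s)"
        by (auto intro!: derivative_eq_intros)
      from has_derivative_compose[OF this D[OF inW[OF that]]]
      have "((\<lambda>s. f (x + s *\<^sub>R v + q *\<^sub>R w)) has_derivative (\<lambda>h. D (x + s *\<^sub>R v + q *\<^sub>R w) (h *\<^sub>R v))) (at s)" .
      moreover have "(\<lambda>h. D (x + s *\<^sub>R v + q *\<^sub>R w) (h *\<^sub>R v)) = (*) (D (x + s *\<^sub>R v + q *\<^sub>R w) v)"
        using has_derivative_linear[OF D[OF inW[OF that]]] by (simp add: linear_scale fun_eq_iff)
      ultimately show ?thesis by (simp add: has_field_derivative_def)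
    qed
    \<comment> \<open>The increment of \<open>?h\<close> over [0, t] is the second difference. The
      summand \<open>0 *\<^sub>R w\<close> lets \<open>der\<close> apply with q = 0 as well.\<close>
    let ?h = "\<lambda>s. f (x + s *\<^sub>R v + t *\<^sub>R w) - f (x + s *\<^sub>R v + 0 *\<^sub>R w)"
    have "\<exists>z>0. z < t \<and> ?h t - ?h 0 =
        (t - 0) * (D (x + z *\<^sub>R v + t *\<^sub>R w) v - D (x + z *\<^sub>R v + 0 *\<^sub>R w) v)"
      using t by (intro MVT2 DERIV_diff der) auto
    then obtain z where z: "0 < z" "z < t" and
      h: "?h t - ?h 0 = t * (D (x + z *\<^sub>R v + t *\<^sub>R w) v - D (x + z *\<^sub>R v) v)"
      by auto
    have *: "\<bar>D (x + z *\<^sub>R v + q *\<^sub>R w) v - D x v - A (z *\<^sub>R v + q *\<^sub>R w)\<bar> \<le> e' * (t * n)"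
      if "0 \<le> q" "q \<le> t" for q
    proof -
      have "norm (z *\<^sub>R v + q *\<^sub>R w) \<le> t * n" using near z that by simp
      moreover have "x + z *\<^sub>R v + q *\<^sub>R w - x = z *\<^sub>R v + q *\<^sub>R w" by simp
      ultimately have "norm (D (x + z *\<^sub>R v + q *\<^sub>R w) v - D x v - A (z *\<^sub>R v + q *\<^sub>R w)) \<le>
          e' * norm (z *\<^sub>R v + q *\<^sub>R w)"
        using d2(2)[of "x + z *\<^sub>R v + q *\<^sub>R w"] tn by simp
      also have "\<dots> \<le> e' * (t * n)"
        using \<open>norm (z *\<^sub>R v + q *\<^sub>R w) \<le> t * n\<close> e' by (intro mult_left_mono) auto
      finally show ?thesis by simp
    qed
    \<comment> \<open>Subtracting the estimates for q = t and q = 0 cancels \<open>D x v\<close> and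
      \<open>A (z *\<^sub>R v)\<close>, so the unknown position of z drops out.\<close>
    have "\<bar>D (x + z *\<^sub>R v + t *\<^sub>R w) v - D (x + z *\<^sub>R v) v - t * A w\<bar> \<le> 2 * (e' * (t * n))"
      using *[of t] *[of 0] t by (simp add: linear_add[OF lin] linear_scale[OF lin])
    also have "2 * (e' * (t * n)) = e * t" using n by (simp add: e'_def)
    finally have "t * \<bar>D (x + z *\<^sub>R v + t *\<^sub>R w) v - D (x + z *\<^sub>R v) v - t * A w\<bar> \<le> t * (e * t)"
      using t by (intro mult_left_mono) auto
    moreover have "t * \<bar>p - t * A w\<bar> = \<bar>t * p - t\<^sup>2 * A w\<bar>" for p
    proof -
      have "t * p - t\<^sup>2 * A w = t * (p - t * A w)"
        by (simp add: power2_eq_square right_diff_distrib)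
      then show ?thesis using t by (simp only: abs_mult abs_of_pos)
    qed
    moreover have "f (x + t *\<^sub>R v + t *\<^sub>R w) - f (x + t *\<^sub>R v) - f (x + t *\<^sub>R w) + f x = ?h t - ?h 0"
      by simp
    ultimately show ?thesis
      unfolding h by (simp only: power2_eq_square mult_ac)
  qed
  ultimately show ?thesis by blast
qed

lemma second_derivative_symmetric_real:
  fixes f :: "'a::real_normed_vector \<Rightarrow> real"
  assumes W: "open W" "x \<in> W" and D: "\<And>y. y \<in> W \<Longrightarrow> (f has_derivative D y) (at y)"
    and A: "((\<lambda>y. D y v) has_derivative A) (at x)"
    and B: "((\<lambda>y. D y w) has_derivative B) (at x)"
  shows "A w = B v"
proof -
  have "\<bar>A w - B v\<bar> \<le> 0 + e" if "e > 0" for e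
  proof -
    have "e / 2 > 0" using that by simp
    note second_difference_approx[OF W D A this, of w]
    then obtain d1 where d1: "d1 > 0" "\<And>t. 0 < t \<Longrightarrow> t < d1 \<Longrightarrow>
      \<bar>f (x + t *\<^sub>R v + t *\<^sub>R w) - f (x + t *\<^sub>R v) - f (x + t *\<^sub>R w) + f x - t\<^sup>2 * A w\<bar> \<le> e / 2 * t\<^sup>2"
      by blast
    note second_difference_approx[OF W D B \<open>e / 2 > 0\<close>, of v]
    then obtain d2 where d2: "d2 > 0" "\<And>t. 0 < t \<Longrightarrow> t < d2 \<Longrightarrow>
      \<bar>f (x + t *\<^sub>R w + t *\<^sub>R v) - f (x + t *\<^sub>R w) - f (x + t *\<^sub>R v) + f x - t\<^sup>2 * B v\<bar> \<le> e / 2 * t\<^sup>2"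
      by blast
    obtain t where t: "0 < t" "t < min d1 d2"
      using d1(1) d2(1) by (meson dense min_less_iff_conj)
    \<comment> \<open>Swapping v and w gives the same four points, so one second difference is
      within \<open>e / 2 * t\<^sup>2\<close> of both \<open>t\<^sup>2 * A w\<close> and
      \<open>t\<^sup>2 * B v\<close>.\<close>
    have "x + t *\<^sub>R w + t *\<^sub>R v = x + t *\<^sub>R v + t *\<^sub>R w" by simp
    note d2(2)[of t, unfolded this]
    then have "\<bar>t\<^sup>2 * A w - t\<^sup>2 * B v\<bar> \<le> e / 2 * t\<^sup>2 + e / 2 * t\<^sup>2"
      using d1(2)[of t] t by linarith
    then have "\<bar>t\<^sup>2 * A w - t\<^sup>2 * B v\<bar> \<le> e * t\<^sup>2"
      by (simp flip: distrib_right)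
    moreover have "\<bar>t\<^sup>2 * A w - t\<^sup>2 * B v\<bar> = t\<^sup>2 * \<bar>A w - B v\<bar>"
      by (simp add: abs_mult flip: right_diff_distrib)
    ultimately have "t\<^sup>2 * \<bar>A w - B v\<bar> \<le> t\<^sup>2 * e"
      by (simp only: mult.commute[of e])
    then show ?thesis using t by simp
  qed
  then have "\<bar>A w - B v\<bar> \<le> 0" by (rule field_le_epsilon)
  then show ?thesis by simp
qed

lemma second_derivative_symmetric:
  fixes f :: "'a::real_normed_vector \<Rightarrow> 'b::real_inner"
  assumes W: "open W" "x \<in> W" and D: "\<And>y. y \<in> W \<Longrightarrow> (f has_derivative D y) (at y)"
    and A: "((\<lambda>y. D y v) has_derivative A) (at x)"
    and B: "((\<lambda>y. D y w) has_derivative B) (at x)"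
  shows "A w = B v"
proof -
  have "A w \<bullet> b = B v \<bullet> b" for b
    by (rule second_derivative_symmetric_real[OF W, where f="\<lambda>y. f y \<bullet> b" and D="\<lambda>y h. D y h \<bullet> b"
          and A="\<lambda>h. A h \<bullet> b" and B="\<lambda>h. B h \<bullet> b"])
       (auto intro!: has_derivative_inner_left D A B)
  then show ?thesis
    by (metis inner_eq_zero_iff inner_diff_left right_minus_eq)
qed

section \<open>Tangent spaces of immersed submanifolds\<close>

text \<open>The tangent space collects vectors from all charts at a point. Another chart is locally
  \<phi> after a transition map, whose derivative sends V into V, so it contributes nothing new.
  This is what allows two tangent vectors to be realised in a single chart.\<close>

lemma tangent_space_eq_chart:
  assumes M: "immersed_submanifold T V A" and c: "(U, \<phi>) \<in> A" "u \<in> U"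
    and \<phi>': "(\<phi> has_derivative \<phi>') (at u within U)"
  shows "tangent_space V A (\<phi> u) = \<phi>' ` V"
proof
  show "\<phi>' ` V \<subseteq> tangent_space V A (\<phi> u)"
    using c \<phi>' by (fastforce simp: tangent_space_def)
  show "tangent_space V A (\<phi> u) \<subseteq> \<phi>' ` V"
  proof
    fix y assume "y \<in> tangent_space V A (\<phi> u)"
    then obtain U' \<psi> u' \<psi>' v where c': "(U', \<psi>) \<in> A" "u' \<in> U'" "\<psi> u' = \<phi> u"
      and \<psi>': "(\<psi> has_derivative \<psi>') (at u' within U')" and v: "v \<in> V" "y = \<psi>' v"
      by (auto simp: tangent_space_def)
    have V: "subspace V" using M by (simp add: immersed_submanifold_def)
    have hom: "openin (top_of_set V) U \<and> openin T (\<phi> ` U) \<and>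
        homeomorphic_map (top_of_set U) (subtopology T (\<phi> ` U)) \<phi>"
      if "(U, \<phi>) \<in> A" for U \<phi>
      using M that unfolding immersed_submanifold_def by blast
    define \<tau> where "\<tau> = inv_into U \<phi> \<circ> \<psi>"
    define S where "S = U' \<inter> \<psi> -` (\<phi> ` U)"
    have "smooth_on S \<tau>"
      using M c c' unfolding immersed_submanifold_def S_def \<tau>_def by blast
    moreover have u'S: "u' \<in> S" using c c' by (auto simp: S_def)
    \<comment> \<open>The extension g is differentiable in the full space; within
      \<open>N \<inter> S\<close> its derivative is one of the transition map \<tau>.\<close>
    ultimately obtain N g where N: "open N" "u' \<in> N" "\<forall>n. Ck_on n N g" "\<forall>y\<in>N \<inter> S. g y = \<tau> y"
      unfolding smooth_on_def by blast
    have "Ck_on (Suc 0) N g" using N by blast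
    then obtain g' where g': "(g has_derivative g') (at u')"
      using N(2) by (auto simp: differentiable_def)
    have "openin (top_of_set U') S"
    proof -
      have "continuous_map (top_of_set U') (subtopology T (\<psi> ` U')) \<psi>"
        using hom[OF c'(1)] homeomorphic_imp_continuous_map by blast
      then have "continuous_map (top_of_set U') T \<psi>"
        by (rule continuous_map_into_fulltopology)
      from openin_continuous_map_preimage[OF this, of "\<phi> ` U"] hom[OF c(1)]
      show ?thesis by (simp add: S_def Int_def vimage_def)
    qed
    then have "openin (top_of_set V) S"
      using hom[OF c'(1)] openin_trans by blast
    then have S': "openin (top_of_set V) (N \<inter> S)"
      using openin_Int_open[OF _ N(1)] by (simp only: Int_commute[of N])
    have mem: "u' \<in> N \<inter> S" using N u'S by blast
    have "inj_on \<phi> U"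
      using hom[OF c(1)] homeomorphic_imp_injective_map by force
    then have \<tau>u: "\<tau> u' = u" using c c' by (simp add: \<tau>_def)
    have \<tau>in: "\<tau> ` S \<subseteq> U" by (auto simp: \<tau>_def S_def inv_into_into)
    have \<phi>\<tau>: "\<phi> (\<tau> s) = \<psi> s" if "s \<in> S" for s
      using that by (auto simp: \<tau>_def S_def f_inv_into_f)
    have \<tau>': "(\<tau> has_derivative g') (at u' within N \<inter> S)"
      by (rule has_derivative_transform[OF mem _ has_derivative_at_withinI[OF g']]) (use N in auto)
    have "((\<lambda>s. \<phi> (\<tau> s)) has_derivative (\<lambda>h. \<phi>' (g' h))) (at u' within N \<inter> S)"
      by (rule has_derivative_in_compose[OF \<tau>'], unfold \<tau>u, rule has_derivative_subset[OF \<phi>'])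
         (use \<tau>in in auto)
    then have "(\<psi> has_derivative (\<lambda>h. \<phi>' (g' h))) (at u' within N \<inter> S)"
      by (rule has_derivative_transform[OF mem, rotated]) (use \<phi>\<tau> in auto)
    moreover have "(\<psi> has_derivative \<psi>') (at u' within N \<inter> S)"
      by (rule has_derivative_subset[OF \<psi>']) (auto simp: S_def)
    ultimately have "\<psi>' v = \<phi>' (g' v)"
      using has_derivative_unique_on_subspace[OF V S' mem v(1)] by blast
    \<comment> \<open>The extension g may leave V, but \<tau> has its values in U, a subset of
      V.\<close>
    moreover have "g' v \<in> V"
    proof (rule has_derivative_maps_subspace[OF V S' mem v(1) \<tau>' V])
      show "\<tau> ` (N \<inter> S) \<subseteq> V"
        using \<tau>in hom[OF c(1)] openin_imp_subset by blast
    qed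
    ultimately show "y \<in> \<phi>' ` V" using v by blast
  qed
qed

text \<open>This keeps of a leaf through p just one chart, replaced by a smooth extension g to an
  open set W, so that second derivatives are available. Off S the values of g need not lie on the
  leaf; hence the fibre condition is restricted to S.\<close>

lemma integrable_distribution_local_leaf:
  fixes D :: "'a::euclidean_space \<Rightarrow> 'a set"
  assumes "integrable_distribution D"
  obtains V S W :: "'a set" and g :: "'a \<Rightarrow> 'a" and u where "subspace V" "openin (top_of_set V) S" "u \<in> S" "S \<subseteq> W" "open W"
    "\<And>n. Ck_on n W g" "g u = p"
    "\<And>s. s \<in> S \<Longrightarrow> frechet_derivative g (at s) ` V = D (g s)"
proof -
  obtain T V A where M: "immersed_submanifold T V A" and p: "p \<in> topspace T"
    and D: "\<And>q. q \<in> topspace T \<Longrightarrow> tangent_space V A q = D q"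
    using assms unfolding integrable_distribution_def by blast
  have top: "topspace T = (\<Union>(U, \<phi>)\<in>A. \<phi> ` U)" and V: "subspace V"
    using M by (auto simp: immersed_submanifold_def)
  obtain U \<phi> u where c: "(U, \<phi>) \<in> A" "u \<in> U" "\<phi> u = p"
    using p top by auto
  have "\<forall>(U, \<phi>)\<in>A. openin (top_of_set V) U"
    using M by (auto simp: immersed_submanifold_def)
  then have U: "openin (top_of_set V) U"
    using c(1) by auto
  have "\<forall>(U, \<phi>)\<in>A. smooth_on U \<phi> \<and>
      (\<forall>s\<in>U. \<exists>\<phi>'. (\<phi> has_derivative \<phi>') (at s within U) \<and> inj_on \<phi>' V)"
    using M unfolding immersed_submanifold_def by (elim conjE) assumption
  from bspec[OF this c(1)] have sm: "smooth_on U \<phi>"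
    and der: "\<And>s. s \<in> U \<Longrightarrow> \<exists>\<phi>'. (\<phi> has_derivative \<phi>') (at s within U)"
    by auto
  obtain W g where W: "open W" "u \<in> W" "\<forall>n. Ck_on n W g" "\<forall>y\<in>W \<inter> U. g y = \<phi> y"
    using bspec[OF sm[unfolded smooth_on_def] c(2)] by (elim exE conjE) (rule that)
  show ?thesis
  proof
    show "subspace V" by fact
    show S: "openin (top_of_set V) (W \<inter> U)"
      using openin_Int_open[OF U W(1)] by (simp add: Int_commute)
    show "u \<in> W \<inter> U" "W \<inter> U \<subseteq> W" "open W" "Ck_on n W g" "g u = p" for n
      using W c by auto
    fix s assume s: "s \<in> W \<inter> U"
    obtain \<phi>' where \<phi>': "(\<phi> has_derivative \<phi>') (at s within U)"
      using der s by blast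
    have "Ck_on (Suc 0) W g" using W(3) by (rule spec)
    then have "(g has_derivative frechet_derivative g (at s)) (at s)"
      using s by (simp add: frechet_derivative_works)
    then have "(g has_derivative frechet_derivative g (at s)) (at s within W \<inter> U)"
      by (rule has_derivative_at_withinI)
    moreover have "(g has_derivative \<phi>') (at s within W \<inter> U)"
      by (rule has_derivative_transform[OF s _ has_derivative_subset[OF \<phi>']]) (use W in auto)
    ultimately have "frechet_derivative g (at s) v = \<phi>' v" if "v \<in> V" for v
      using has_derivative_unique_on_subspace[OF V S s that] by blast
    then have "frechet_derivative g (at s) ` V = \<phi>' ` V" by (rule image_cong[OF refl])
    also have "\<dots> = tangent_space V A (\<phi> s)"
      using tangent_space_eq_chart[OF M c(1) _ \<phi>'] s by auto
    also have "\<dots> = D (\<phi> s)"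
      by (rule D) (use top c(1) s in auto)
    also have "\<phi> s = g s" using W s by simp
    finally show "frechet_derivative g (at s) ` V = D (g s)" .
  qed
qed

section \<open>The characteristic distribution\<close>

lemma smooth_on_bounded_linear:
  assumes "bounded_linear f"
  shows "smooth_on UNIV f"
proof -
  \<comment> \<open>The derivative of f in a fixed direction is a constant map, which settles all
    positive orders.\<close>
  have const: "Ck_on n UNIV (\<lambda>x::'a. c::'b)" for n c
    by (induction n arbitrary: c) auto
  have "frechet_derivative f (at x) = f" for x
    using bounded_linear_imp_has_derivative[OF assms] by (rule frechet_derivative_at[symmetric])
  then have "Ck_on n UNIV f" for n
    using assms const
    by (cases n) (auto simp: linear_continuous_on intro: bounded_linear_imp_differentiable)
  then show ?thesis
    unfolding smooth_on_def by (metis IntD2 UNIV_I open_UNIV)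
qed

text \<open>The linear test functions \<open>\<lambda>y. y \<bullet> z\<close> already determine
  every component of the field.\<close>

lemma hamiltonian_vf_unique:
  fixes X Y :: "'a::euclidean_space \<Rightarrow> 'a"
  assumes "hamiltonian_vf B f X" "hamiltonian_vf B f Y"
  shows "X = Y"
proof
  fix x :: 'a
  have bl: "bounded_linear (\<lambda>y. y \<bullet> z)" for z :: 'a
    by (rule bounded_linear_inner_left)
  have "frechet_derivative (\<lambda>y. y \<bullet> z) (at x) = (\<lambda>y. y \<bullet> z)" for z :: 'a
    using bounded_linear_imp_has_derivative[OF bl] by (rule frechet_derivative_at[symmetric])
  then have "X x \<bullet> z = Y x \<bullet> z" for z
    using assms smooth_on_bounded_linear[OF bl[of z]] unfolding hamiltonian_vf_def by metis
  then show "X x = Y x"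
    by (metis inner_eq_zero_iff inner_diff_left right_minus_eq)
qed

text \<open>Both conditions are linear in (u, v), so they need checking on Hamiltonian fields only.
  The first says that the length of \<gamma> is preserved; the second is the vanishing of the 1-form
  d(\<gamma> . K) - m r^2 \<Omega> . d\<gamma>.\<close>

lemma characteristic_distribution_rank1:
  fixes \<gamma> K :: "real^3" and II :: "real^3^3"
    and m r :: real
  defines "\<Omega> \<equiv> Omega m r II \<gamma> K"
  assumes "(u, v) \<in> characteristic_distribution (rank1_bracket m r II) (\<gamma>, K)"
  shows "\<gamma> \<bullet> u = 0" and "\<gamma> \<bullet> v + K \<bullet> u - m * r\<^sup>2 * (\<Omega> \<bullet> u) = 0"
proof -
  define Z where "Z = {(u, v). \<gamma> \<bullet> u = 0 \<and> \<gamma> \<bullet> v + K \<bullet> u - m * r\<^sup>2 * (\<Omega> \<bullet> u) = 0}"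
  have "subspace Z"
    by (auto simp: subspace_def Z_def zero_prod_def inner_add_right algebra_simps)
       (simp add: algebra_simps flip: distrib_left)
  moreover have "(cross3 \<gamma> a,
      cross3 (K - (m * r\<^sup>2) *\<^sub>R \<Omega> + (m * r\<^sup>2 * (\<Omega> \<bullet> \<gamma>)) *\<^sub>R \<gamma>) a + cross3 \<gamma> b) \<in> Z" for a b
  proof -
    \<comment> \<open>For arbitrary scalars p and q this is a triple product identity: the K terms
      cancel, the \<Omega> terms cancel, and the rest is orthogonal to \<gamma>.\<close>
    have "\<gamma> \<bullet> (cross3 (K - p *\<^sub>R \<Omega> + q *\<^sub>R \<gamma>) a + cross3 \<gamma> b)
        + K \<bullet> cross3 \<gamma> a - p * (\<Omega> \<bullet> cross3 \<gamma> a) = 0" for p q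
      by (simp add: cross3_simps)
    then show ?thesis by (simp add: Z_def dot_cross_self)
  qed
  then have "X (\<gamma>, K) \<in> Z" if "hamiltonian_vf (rank1_bracket m r II) f X" for f X
    unfolding hamiltonian_vf_unique[OF that hamiltonian_vf_rank1]
    by (simp add: Let_def \<Omega>_def)
  ultimately have "characteristic_distribution (rank1_bracket m r II) (\<gamma>, K) \<subseteq> Z"
    unfolding characteristic_distribution_def by (intro span_minimal) auto
  then show "\<gamma> \<bullet> u = 0" and "\<gamma> \<bullet> v + K \<bullet> u - m * r\<^sup>2 * (\<Omega> \<bullet> u) = 0"
    using assms by (auto simp: Z_def)
qed

lemma characteristic_distribution_rank1_mem:
  fixes \<gamma> K a b :: "real^3" and II :: "real^3^3"
    and m r :: real
  defines "\<Omega> \<equiv> Omega m r II \<gamma> K"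
  shows "(cross3 \<gamma> a, cross3 (K - (m * r\<^sup>2) *\<^sub>R \<Omega> + (m * r\<^sup>2 * (\<Omega> \<bullet> \<gamma>)) *\<^sub>R \<gamma>) a + cross3 \<gamma> b)
    \<in> characteristic_distribution (rank1_bracket m r II) (\<gamma>, K)"
proof -
  \<comment> \<open>A linear function realises any prescribed gradients; b comes first because
    points are pairs (\<gamma>, K).\<close>
  define f where "f = (\<lambda>y :: (real^3) \<times> (real^3). y \<bullet> (b, a))"
  have bl: "bounded_linear f"
    unfolding f_def by (rule bounded_linear_inner_left)
  have D: "frechet_derivative (\<lambda>y::real^3. y \<bullet> c + k) (at x) = (\<lambda>y. y \<bullet> c)" for c k x
    by (rule frechet_derivative_at[symmetric]) (auto intro!: derivative_eq_intros)
  have "grad_gamma f (\<gamma>, K) = b"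
    using D[of b "K \<bullet> a"] by (simp add: grad_gamma_def f_def inner_axis' vec_eq_iff)
  moreover have "grad_K f (\<gamma>, K) = a"
    using D[of a "\<gamma> \<bullet> b"] by (simp add: grad_K_def f_def inner_axis' vec_eq_iff add.commute)
  ultimately show ?thesis
    unfolding characteristic_distribution_def
    using smooth_on_bounded_linear[OF bl] hamiltonian_vf_rank1[of m r II f]
    by (intro span_base CollectI exI[of _ f] exI conjI) (auto simp: Let_def \<Omega>_def)
qed

section \<open>Closed form of \<Omega> and its linearisation at K = 0\<close>

text \<open>This is the Sherman-Morrison formula: K depends on \<Omega> through a rank-one
  perturbation of the diagonal matrix, and J is the inverse of that matrix.\<close>

lemma Omega_eq:
  fixes d \<gamma> K :: "real^3" and m r :: real
  assumes "m > 0" and d: "\<And>i. d $ i > 0"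
  defines "J \<equiv> \<lambda>x :: real^3. \<chi> i. x $ i / d $ i"
  shows "1 + m * r\<^sup>2 * (J \<gamma> \<bullet> \<gamma>) > 0"
    and "Omega m r (diag_matrix d) \<gamma> K =
      J K - (m * r\<^sup>2 * (J K \<bullet> \<gamma>) / (1 + m * r\<^sup>2 * (J \<gamma> \<bullet> \<gamma>))) *\<^sub>R J \<gamma>"
proof -
  have "J \<gamma> \<bullet> \<gamma> \<ge> 0"
    using d by (auto simp: J_def inner_vec_def less_imp_le intro!: sum_nonneg)
  then show pos: "1 + m * r\<^sup>2 * (J \<gamma> \<bullet> \<gamma>) > 0"
    using \<open>m > 0\<close> by (intro add_pos_nonneg mult_nonneg_nonneg) auto
  \<comment> \<open>The scalar q will turn out to be m r^2 (\<Omega> . \<gamma>), the coefficient of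
    \<gamma> in the defining equation.\<close>
  define q where "q = m * r\<^sup>2 * (J K \<bullet> \<gamma>) / (1 + m * r\<^sup>2 * (J \<gamma> \<bullet> \<gamma>))"
  have DJ: "diag_matrix d *v J x = x" for x
    using d[of 1] d[of 2] d[of 3]
    by (simp add: J_def diag_matrix_def matrix_vector_mult_def vec_eq_iff sum_3 forall_3)
  have "q * (1 + m * r\<^sup>2 * (J \<gamma> \<bullet> \<gamma>)) = m * r\<^sup>2 * (J K \<bullet> \<gamma>)"
    using pos by (simp add: q_def)
  then have "m * r\<^sup>2 * ((J K - q *\<^sub>R J \<gamma>) \<bullet> \<gamma>) = q"
    by (simp add: inner_diff_left algebra_simps)
  then have "K = diag_matrix d *v (J K - q *\<^sub>R J \<gamma>) + (m * r\<^sup>2 * ((J K - q *\<^sub>R J \<gamma>) \<bullet> \<gamma>)) *\<^sub>R \<gamma>"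
    by (simp add: matrix_vector_mult_diff_distrib matrix_vector_mult_scaleR DJ)
  then show "Omega m r (diag_matrix d) \<gamma> K = J K - q *\<^sub>R J \<gamma>"
    unfolding Omega_def by (intro the1_equality Omega_unique_existence[OF assms(1,2)]) simp
qed

text \<open>Since \<Omega> is linear in K, it vanishes at K = 0 for every \<gamma>; its
  \<gamma>-derivative therefore vanishes there too, and only the variation v of K
  contributes.\<close>

lemma Omega_has_derivative_at_zero_momentum:
  fixes d \<gamma> :: "real^3" and m r :: real
  assumes "m > 0" and d: "\<And>i. d $ i > 0"
  shows "((\<lambda>(\<gamma>, K). Omega m r (diag_matrix d) \<gamma> K) has_derivative
    (\<lambda>(u, v). Omega m r (diag_matrix d) \<gamma> v)) (at (\<gamma>, 0))"
proof -
  define J where "J = (\<lambda>x :: real^3. \<chi> i. x $ i / d $ i)"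
  have "linear J"
    by (auto intro!: linearI simp: J_def vec_eq_iff add_divide_distrib)
  then have "bounded_linear J" by (simp add: linear_conv_bounded_linear)
  note J' = bounded_linear.has_derivative[OF this]
  have J0: "J 0 = 0" using \<open>linear J\<close> by (rule linear_0)
  have "(\<chi> i. x $ i / d $ i) = J x" for x by (simp add: J_def)
  note eq = Omega_eq[OF assms, unfolded this]
  have nz: "1 + m * r\<^sup>2 * (J \<gamma> \<bullet> \<gamma>) \<noteq> 0" using eq(1)[of r \<gamma>] by simp
  show ?thesis
    unfolding eq(2) case_prod_beta
    by (rule has_derivative_eq_rhs, (rule derivative_intros J' | simp only: fst_conv nz not_False_eq_True)+)
       (use nz in \<open>simp_all add: J0 fun_eq_iff\<close>)
qed

section \<open>The contradiction on a leaf through (e_1, 0)\<close>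

lemma rank1_not_integrable:
  fixes d :: "real^3" and m r :: real
  assumes "m > 0" "r > 0" and d: "\<And>i. d $ i > 0"
  shows "\<not> integrable_distribution
    (characteristic_distribution (rank1_bracket m r (diag_matrix d)))"
proof
  let ?\<Delta> = "characteristic_distribution (rank1_bracket m r (diag_matrix d))"
  let ?\<Omega> = "Omega m r (diag_matrix d)"
  let ?e1 = "axis 1 1 :: real^3" and ?e2 = "axis 2 1 :: real^3"
  assume "integrable_distribution ?\<Delta>"
  then obtain V S W :: "((real^3) \<times> (real^3)) set" and g u where V: "subspace V" "openin (top_of_set V) S" "u \<in> S"
    and W: "S \<subseteq> W" "open W" and smooth: "\<And>n. Ck_on n W g" and gu: "g u = (?e1, 0)"
    and leaf: "\<And>s. s \<in> S \<Longrightarrow> frechet_derivative g (at s) ` V = ?\<Delta> (g s)"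
    by (rule integrable_distribution_local_leaf[where p="(?e1, 0)"]) (rule that)
  define D where "D = (\<lambda>s. frechet_derivative g (at s))"
  have uW: "u \<in> W" using V W by blast
  have D: "(g has_derivative D s) (at s)" if "s \<in> W" for s
    using smooth[of "Suc 0"] that by (simp add: D_def frechet_derivative_works)
  \<comment> \<open>Second derivatives come one fixed direction v at a time: \<open>D2 v h\<close>
    will be the derivative of \<open>\<lambda>s. D s v\<close> at u along h.\<close>
  have "\<exists>A. ((\<lambda>s. D s v) has_derivative A) (at u)" for v
    using smooth[of "Suc (Suc 0)"] uW
    by (auto simp: D_def differentiable_def simp del: split_paired_All)
  then obtain D2 where D2: "\<And>v. ((\<lambda>s. D s v) has_derivative D2 v) (at u)"
    by metis
  have \<Omega>0: "?\<Omega> \<gamma> 0 = 0" for \<gamma>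
    by (simp add: Omega_eq[OF \<open>m > 0\<close> d] zero_vec_def[symmetric])
  have \<Omega>': "((\<lambda>s. ?\<Omega> (fst (g s)) (snd (g s))) has_derivative (\<lambda>h. ?\<Omega> ?e1 (snd (D u h)))) (at u)"
    using has_derivative_compose[OF D[OF uW],
        of "\<lambda>(\<gamma>, K). ?\<Omega> \<gamma> K" "\<lambda>(a, b). ?\<Omega> ?e1 b"]
      Omega_has_derivative_at_zero_momentum[OF \<open>m > 0\<close> d, of r ?e1]
    by (simp add: gu case_prod_beta)
  \<comment> \<open>This is the derivative along h of the 1-form evaluated on \<open>D s v\<close>.
    The terms containing K or \<Omega> undifferentiated vanish at u, as K = 0 there.\<close>
  have constraint: "?e1 \<bullet> snd (D2 v h) + fst (D u h) \<bullet> snd (D u v) + snd (D u h) \<bullet> fst (D u v)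
      - m * r\<^sup>2 * (?\<Omega> ?e1 (snd (D u h)) \<bullet> fst (D u v)) = 0"
    if vh: "v \<in> V" "h \<in> V" for v h
  proof -
    let ?F = "\<lambda>s. fst (g s) \<bullet> snd (D s v) + snd (g s) \<bullet> fst (D s v)
      - m * r\<^sup>2 * (?\<Omega> (fst (g s)) (snd (g s)) \<bullet> fst (D s v))"
    have "?F s = 0" if "s \<in> S" for s
    proof -
      have "(fst (D s v), snd (D s v)) \<in> ?\<Delta> (fst (g s), snd (g s))"
        using leaf[OF that] vh(1) by (auto simp: D_def)
      then show ?thesis by (rule characteristic_distribution_rank1)
    qed
    then have sub: "?F ` S \<subseteq> {0}" by blast
    let ?F' = "\<lambda>h. ?e1 \<bullet> snd (D2 v h) + fst (D u h) \<bullet> snd (D u v) + snd (D u h) \<bullet> fst (D u v)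
      - m * r\<^sup>2 * (?\<Omega> ?e1 (snd (D u h)) \<bullet> fst (D u v))"
    have "(?F has_derivative ?F') (at u)"
      by (rule has_derivative_eq_rhs, (rule derivative_intros \<Omega>' D2 D uW)+)
         (auto simp: gu \<Omega>0 fun_eq_iff)
    then have "(?F has_derivative ?F') (at u within S)"
      by (rule has_derivative_at_withinI)
    \<comment> \<open>\<open>?F\<close> vanishes on S only, so its derivative is known to vanish
      only along V.\<close>
    from has_derivative_maps_subspace[OF V vh(2) this _ sub]
    show ?thesis by simp
  qed
  \<comment> \<open>e_2 is the cross product of e_1 with - e_3, which is inserted as b here and as a
    in the next fact; the coefficient of a in the second component is zero at K = 0.\<close>
  have "(0, ?e2) \<in> ?\<Delta> (?e1, 0)"
    using characteristic_distribution_rank1_mem[of ?e1 0 0 m r "diag_matrix d" "- axis 3 1"]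
    by (simp add: \<Omega>0 cross_basis)
  moreover have "(?e2, 0) \<in> ?\<Delta> (?e1, 0)"
    using characteristic_distribution_rank1_mem[of ?e1 "- axis 3 1" 0 m r "diag_matrix d" 0]
    by (simp add: \<Omega>0 cross_basis)
  ultimately obtain a b where ab: "a \<in> V" "b \<in> V" "D u a = (0, ?e2)" "D u b = (?e2, 0)"
    unfolding leaf[OF V(3), unfolded gu, symmetric] D_def by (force simp: image_iff)
  have "D2 a b = D2 b a"
    using W(2) uW D D2 D2 by (rule second_derivative_symmetric)
  \<comment> \<open>Both constraints contain the same second-derivative term and one summand e_2 .
    e_2. Only the one with \<open>v = b\<close> and \<open>h = a\<close> has an \<Omega> term, so
    subtraction isolates it.\<close>
  then have "m * r\<^sup>2 * (?\<Omega> ?e1 ?e2 \<bullet> ?e2) = 0"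
    using constraint[OF ab(1,2)] constraint[OF ab(2,1)] ab \<Omega>0 by simp
  \<comment> \<open>The rank-one correction in the closed form drops out because e_2 / d_2 is
    orthogonal to e_1.\<close>
  moreover have "?\<Omega> ?e1 ?e2 \<bullet> ?e2 = 1 / d $ 2"
    by (simp add: Omega_eq[OF \<open>m > 0\<close> d] inner_vec_def sum_3 axis_def)
  ultimately show False
    using assms(1,2) d[of 2] by simp
qed

theorem proposition2p5:
  fixes m r I\<^sub>1 I\<^sub>2 I\<^sub>3 :: real
  assumes "m > 0" and "r > 0"
    and "I\<^sub>1 > 0" and "I\<^sub>2 > 0" and "I\<^sub>3 > 0"
  shows "\<not> integrable_distribution
    (characteristic_distribution (rank1_bracket m r (diag_matrix (vector [I\<^sub>1, I\<^sub>2, I\<^sub>3]))))"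
proof (rule rank1_not_integrable)
  show "vector [I\<^sub>1, I\<^sub>2, I\<^sub>3] $ i > 0" for i :: 3
    using assms(3-5) exhaust_3[of i] by auto
qed fact+

end
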